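(* Let $\hat{\mathcal D}$ be the map sending each differentiable function $f:a\to b$ to $\hat{\mathcal D} f=\mathcal D^+ f\in\mathsf D(a,b)$, where the operations on $\mathsf D$ are those defined in the context. Then $\hat{\mathcal D}$ is a functor, a monoidal functor and a cartesian functor, and it preserves the numeric operations. That is, for all spaces $a,b$ and all differentiable functions $f,g$ of suitable types: (i) $\hat{\mathcal D}\,\mathrm{id}=\mathrm{id}$ and $\hat{\mathcal D}(g\circ f)=\hat{\mathcal D} g\circ\hat{\mathcal D} f$ (for $f:a\to b$, $g:b\to c$); (ii) $\hat{\mathcal D}(f\times g)=\hat{\mathcal D} f\times\hat{\mathcal D} g$ (for $f:a\to c$, $g:b\to d$); (iii) $\hat{\mathcal D}\,\mathrm{exl}=\mathrm{exl}$, $\hat{\mathcal D}\,\mathrm{exr}=\mathrm{exr}$, $\hat{\mathcal D}\,\mathrm{dup}=\mathrm{dup}$; (iv) $\hat{\mathcal D}\,\mathrm{negateC}=\mathrm{negateC}$, $\hat{\mathcal D}\,\mathrm{addC}=\mathrm{addC}$, $\hat{\mathcal D}\,\mathrm{mulC}=\mathrm{mulC}$. In each equation the operations inside the argument of $\hat{\mathcal D}$ are those on ordinary functions, and the other ones are those of $\mathsf D$.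
   Context: Let $K=\mathbb R$ or $\mathbb C$. A "space" is a finite-dimensional normed $K$-vector space; $a\times b$ is the Cartesian product of spaces. $a\multimap b$ is the set of $K$-linear maps $a\to b$. For $f:a\to b$ differentiable at $x\in a$, $\mathcal D f\,x\in a\multimap b$ is the unique linear map with $\lim_{\varepsilon\to 0}\|f(x+\varepsilon)-(f\,x+\mathcal D f\,x\,\varepsilon)\|/\|\varepsilon\|=0$. "Differentiable" means differentiable at every point. For differentiable $f:a\to b$, $\mathcal D^+f:a\to b\times(a\multimap b)$ is $\mathcal D^+ f\,x=(f\,x,\mathcal D f\,x)$. On ordinary functions: $\mathrm{id}$ and $\circ$ are as usual; $(f\times g)(x,y)=(f\,x,g\,y)$; $\mathrm{exl}(x,y)=x$; $\mathrm{exr}(x,y)=y$; $\mathrm{dup}\,x=(x,x)$; and on the scalar field, $\mathrm{negateC}:K\to K$, $x\mapsto -x$; $\mathrm{addC}:K\times K\to K$, $(x,y)\mapsto x+y$; $\mathrm{mulC}:K\times K\to K$, $(x,y)\mapsto xy$. $\mathsf D(a,b)$ is the set of all functions $a\to b\times(a\multimap b)$, regarded as morphisms from $a$ to $b$. For a linear function $f:a\to b$ put $\mathrm{linearD}\,f=(x\mapsto(f\,x,f))\in\mathsf D(a,b)$. Operations on $\mathsf D$: - $\mathrm{id}=\mathrm{linearD}\,\mathrm{id}$; - for $F\in\mathsf D(a,b)$, $G\in\mathsf D(b,c)$: $(G\circ F)(x)=(z,g'\circ f')$ where $(y,f')=F\,x$ and $(z,g')=G\,y$; - for $F\in\mathsf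 D(a,c)$, $G\in\mathsf D(b,d)$: $(F\times G)(x,y)=((z,w),f'\times g')$ where $(z,f')=F\,x$ and $(w,g')=G\,y$; - $\mathrm{exl}=\mathrm{linearD}\,\mathrm{exl}$, $\mathrm{exr}=\mathrm{linearD}\,\mathrm{exr}$, $\mathrm{dup}=\mathrm{linearD}\,\mathrm{dup}$; - $\mathrm{negateC}=\mathrm{linearD}\,\mathrm{negateC}$, $\mathrm{addC}=\mathrm{linearD}\,\mathrm{addC}$, and $\mathrm{mulC}=\big((x,y)\mapsto(xy,\ \mathrm{scale}\,y\mathbin{\triangledown}\mathrm{scale}\,x)\big)$, where $\mathrm{scale}\,x$ is the linear map $t\mapsto xt$ on $K$, and for linear $p:c\multimap a$, $q:d\multimap a$, $p\mathbin{\triangledown}q:c\times d\multimap a$ is $(u,v)\mapsto p\,u+q\,v$. *)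

theory Defs
  imports "HOL-Analysis.Analysis"
begin

section \<open>The scalar field: the reals or the complex numbers\<close>

text \<open>
  A class is used, rather than two copies of everything, so that a single type variable
  \<open>'k\<close> stands for either scalar field: its instances are the isometric copies, as normed
  real algebras, of the subfields \<open>\<real>\<close> and \<open>UNIV\<close> of the complex numbers.
\<close>

class real_or_complex = real_normed_field +
  assumes real_or_complex:
    "\<exists>h :: 'a \<Rightarrow> complex.
       (\<forall>x y. h (x + y) = h x + h y) \<and> (\<forall>x y. h (x * y) = h x * h y) \<and>
       (\<forall>r x. h (r *\<^sub>R x) = r *\<^sub>R h x) \<and> (\<forall>x. norm (h x) = norm x) \<and>
       (range h = \<real> \<or> range h = UNIV)"

instance real :: real_or_complex
  by standard (rule exI[of _ complex_of_real], auto simp: Reals_def scaleR_conv_of_real)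

instance complex :: real_or_complex
  by standard (rule exI[of _ "\<lambda>x. x"], auto)


section \<open>Finite-dimensional normed spaces\<close>

text \<open>
  The type supplies addition, norm and topology; the locale parameter supplies the action of
  the scalar field.  No inner product is assumed.  The assumption \<open>scale_of_real\<close> says that
  the real scalar multiplication that comes with the type is the restriction of scalars.
\<close>

locale fin_dim_normed_space = vector_space scale
  for scale :: "'k::real_or_complex \<Rightarrow> 'a::real_normed_vector \<Rightarrow> 'a" +
  assumes norm_scale: "norm (scale k x) = norm k * norm x"
    and scale_of_real: "scale (of_real r) x = r *\<^sub>R x"
    and fin_dim: "\<exists>B. finite B \<and> span B = UNIV"

abbreviation prod_scale ::
    "('k::real_or_complex \<Rightarrow> 'a::real_normed_vector \<Rightarrow> 'a) \<Rightarrow>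
     ('k \<Rightarrow> 'b::real_normed_vector \<Rightarrow> 'b) \<Rightarrow> 'k \<Rightarrow> 'a \<times> 'b \<Rightarrow> 'a \<times> 'b" where
  "prod_scale \<equiv> module_prod.scale"

lemma fin_dim_normed_space_scalars:
  "fin_dim_normed_space ((*) :: 'k::real_or_complex \<Rightarrow> 'k \<Rightarrow> 'k)"
proof -
  have V: "vector_space ((*) :: 'k \<Rightarrow> 'k \<Rightarrow> 'k)"
    by unfold_locales (auto simp: algebra_simps)
  then have M: "module ((*) :: 'k \<Rightarrow> 'k \<Rightarrow> 'k)"
    by (simp add: module_iff_vector_space)
  have "x \<in> module.span (*) {1}" for x :: 'k
    using module.span_scale[OF M module.span_base[OF M, of 1 "{1}"], of x] by simp
  then have "module.span (*) {1::'k} = UNIV" by auto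
  with V show ?thesis
    by (auto simp: fin_dim_normed_space_def fin_dim_normed_space_axioms_def norm_mult
        scaleR_conv_of_real intro!: exI[of _ "{1::'k}"])
qed

lemma fin_dim_normed_space_prod:
  assumes "fin_dim_normed_space sa" and "fin_dim_normed_space sb"
  shows "fin_dim_normed_space (prod_scale sa sb)"
proof -
  interpret a: fin_dim_normed_space sa by fact
  interpret b: fin_dim_normed_space sb by fact
  interpret vector_space_prod sa sb ..
  obtain A B where A: "finite A" "a.span A = UNIV" and B: "finite B" "b.span B = UNIV"
    using a.fin_dim b.fin_dim by blast
  let ?C = "A \<times> {0} \<union> {0} \<times> B"
  have "(x, y) \<in> p.span ?C" for x y
  proof -
    have "(x, 0) \<in> p.span (A \<times> {0})" "(0, y) \<in> p.span ({0} \<times> B)"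
      using A B by (auto simp: span_Times_sing1 span_Times_sing2)
    then have "(x, 0) \<in> p.span ?C" "(0, y) \<in> p.span ?C"
      by (meson p.span_mono subsetD sup_ge1 sup_ge2)+
    from p.span_add[OF this] show ?thesis by simp
  qed
  then have "finite ?C \<and> p.span ?C = UNIV" using A B by auto
  moreover have "norm (scale k x) = norm k * norm x" for k x
    by (simp add: scale_def norm_prod_def a.norm_scale b.norm_scale power_mult_distrib
        real_sqrt_mult flip: distrib_left)
  moreover have "scale (of_real r) x = r *\<^sub>R x" for r x
    by (simp add: scale_def scaleR_prod_def a.scale_of_real b.scale_of_real)
  ultimately show ?thesis by unfold_locales blast+
qed


section \<open>Differentiation\<close>

text \<open>
  Only linearity over \<open>'k\<close> is required of the derivative.  The library's \<open>has_derivative\<close>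
  in addition requires boundedness, which here follows from finite dimension, and
  linearity only over the reals.
  On products the type class provides the Euclidean combination of the two norms; by
  finite-dimensionality any other product norm gives the same derivatives.
\<close>

definition has_deriv_at ::
    "('k::real_or_complex \<Rightarrow> 'a::real_normed_vector \<Rightarrow> 'a) \<Rightarrow>
     ('k \<Rightarrow> 'b::real_normed_vector \<Rightarrow> 'b) \<Rightarrow> ('a \<Rightarrow> 'b) \<Rightarrow> ('a \<Rightarrow> 'b) \<Rightarrow> 'a \<Rightarrow> bool" where
  "has_deriv_at sa sb f f' x \<longleftrightarrow>
     Vector_Spaces.linear sa sb f' \<and>
     ((\<lambda>e. norm (f (x + e) - (f x + f' e)) / norm e) \<longlongrightarrow> 0) (at 0)"

definition differentiable_map ::
    "('k::real_or_complex \<Rightarrow> 'a::real_normed_vector \<Rightarrow> 'a) \<Rightarrow>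
     ('k \<Rightarrow> 'b::real_normed_vector \<Rightarrow> 'b) \<Rightarrow> ('a \<Rightarrow> 'b) \<Rightarrow> bool" where
  "differentiable_map sa sb f \<longleftrightarrow> (\<forall>x. \<exists>f'. has_deriv_at sa sb f f' x)"

definition deriv_at ::
    "('k::real_or_complex \<Rightarrow> 'a::real_normed_vector \<Rightarrow> 'a) \<Rightarrow>
     ('k \<Rightarrow> 'b::real_normed_vector \<Rightarrow> 'b) \<Rightarrow> ('a \<Rightarrow> 'b) \<Rightarrow> 'a \<Rightarrow> ('a \<Rightarrow> 'b)" where
  "deriv_at sa sb f x = (THE f'. has_deriv_at sa sb f f' x)"

definition D_hat ::
    "('k::real_or_complex \<Rightarrow> 'a::real_normed_vector \<Rightarrow> 'a) \<Rightarrow>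
     ('k \<Rightarrow> 'b::real_normed_vector \<Rightarrow> 'b) \<Rightarrow> ('a \<Rightarrow> 'b) \<Rightarrow> 'a \<Rightarrow> 'b \<times> ('a \<Rightarrow> 'b)" where
  "D_hat sa sb f = (\<lambda>x. (f x, deriv_at sa sb f x))"


section \<open>Operations on ordinary functions\<close>

text \<open>
  Identity, composition, products and projections are \<open>id\<close>, \<open>(\<circ>)\<close>, \<open>map_prod\<close>, \<open>fst\<close> and \<open>snd\<close>.
\<close>

definition dup :: "'a \<Rightarrow> 'a \<times> 'a" where
  "dup x = (x, x)"

definition negateC :: "'k::real_or_complex \<Rightarrow> 'k" where
  "negateC x = - x"

definition addC :: "'k::real_or_complex \<times> 'k \<Rightarrow> 'k" where
  "addC = (\<lambda>(x, y). x + y)"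

definition mulC :: "'k::real_or_complex \<times> 'k \<Rightarrow> 'k" where
  "mulC = (\<lambda>(x, y). x * y)"


section \<open>Functions paired with candidate derivatives\<close>

text \<open>
  A morphism is represented by a function into \<open>'b \<times> ('a \<Rightarrow> 'b)\<close>; membership in
  \<open>D_hom\<close> expresses that the second components are linear over \<open>'k\<close>.
\<close>

definition D_hom ::
    "('k::real_or_complex \<Rightarrow> 'a::real_normed_vector \<Rightarrow> 'a) \<Rightarrow>
     ('k \<Rightarrow> 'b::real_normed_vector \<Rightarrow> 'b) \<Rightarrow> ('a \<Rightarrow> 'b \<times> ('a \<Rightarrow> 'b)) set" where
  "D_hom sa sb = {F. \<forall>x. Vector_Spaces.linear sa sb (snd (F x))}"

definition linearD :: "('a \<Rightarrow> 'b) \<Rightarrow> 'a \<Rightarrow> 'b \<times> ('a \<Rightarrow> 'b)" where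
  "linearD f = (\<lambda>x. (f x, f))"

definition idD :: "'a \<Rightarrow> 'a \<times> ('a \<Rightarrow> 'a)" where
  "idD = linearD id"

definition compD ::
    "('b \<Rightarrow> 'c \<times> ('b \<Rightarrow> 'c)) \<Rightarrow> ('a \<Rightarrow> 'b \<times> ('a \<Rightarrow> 'b)) \<Rightarrow> 'a \<Rightarrow> 'c \<times> ('a \<Rightarrow> 'c)"
    (infixl \<open>\<circ>\<^sub>D\<close> 55) where
  "G \<circ>\<^sub>D F = (\<lambda>x. let (y, f') = F x; (z, g') = G y in (z, g' \<circ> f'))"

definition crossD ::
    "('a \<Rightarrow> 'c \<times> ('a \<Rightarrow> 'c)) \<Rightarrow> ('b \<Rightarrow> 'd \<times> ('b \<Rightarrow> 'd)) \<Rightarrow>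
     'a \<times> 'b \<Rightarrow> ('c \<times> 'd) \<times> ('a \<times> 'b \<Rightarrow> 'c \<times> 'd)" (infixr \<open>\<times>\<^sub>D\<close> 70) where
  "F \<times>\<^sub>D G =
     (\<lambda>(x, y). let (z, f') = F x; (w, g') = G y in ((z, w), map_prod f' g'))"

definition exlD :: "'a \<times> 'b \<Rightarrow> 'a \<times> ('a \<times> 'b \<Rightarrow> 'a)" where
  "exlD = linearD fst"

definition exrD :: "'a \<times> 'b \<Rightarrow> 'b \<times> ('a \<times> 'b \<Rightarrow> 'b)" where
  "exrD = linearD snd"

definition dupD :: "'a \<Rightarrow> ('a \<times> 'a) \<times> ('a \<Rightarrow> 'a \<times> 'a)" where
  "dupD = linearD dup"

definition negateCD :: "'k::real_or_complex \<Rightarrow> 'k \<times> ('k \<Rightarrow> 'k)" where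
  "negateCD = linearD negateC"

definition addCD :: "'k::real_or_complex \<times> 'k \<Rightarrow> 'k \<times> ('k \<times> 'k \<Rightarrow> 'k)" where
  "addCD = linearD addC"

definition scale_map :: "'k::real_or_complex \<Rightarrow> 'k \<Rightarrow> 'k" where
  "scale_map x = (\<lambda>t. x * t)"

definition join :: "('c \<Rightarrow> 'a) \<Rightarrow> ('d \<Rightarrow> 'a) \<Rightarrow> 'c \<times> 'd \<Rightarrow> 'a::plus" (infixr \<open>\<nabla>\<close> 65) where
  "p \<nabla> q = (\<lambda>(u, v). p u + q v)"

definition mulCD :: "'k::real_or_complex \<times> 'k \<Rightarrow> 'k \<times> ('k \<times> 'k \<Rightarrow> 'k)" where
  "mulCD = (\<lambda>(x, y). (x * y, scale_map y \<nabla> scale_map x))"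

end

theory Submission
  imports Defs
begin

text \<open>
  Over a complete scalar field the coordinate functionals of a finite independent set are
  bounded: by induction the span of a finite set is closed, hence a vector outside it has
  positive distance from it.  So linear maps out of a finite-dimensional normed space are
  bounded, the derivatives of the statement are the Frechet derivatives of the library, and
  the equations reduce to the chain rule and its companions.
\<close>

section \<open>Completeness of the scalar field\<close>

text \<open>The embedding \<open>h\<close> preserves distances and its range, the reals or all
  complex numbers, is closed. So the image of a Cauchy sequence has its limit in the range, and this
  limit pulls back.\<close>

lemma real_or_complex_Cauchy_convergent:
  fixes X :: "nat \<Rightarrow> 'k::real_or_complex"
  assumes "Cauchy X"
  shows "convergent X"
proof -
  obtain h :: "'k \<Rightarrow> complex" where add: "\<And>x y. h (x + y) = h x + h y"
    and nh: "\<And>x. norm (h x) = norm x" and ran: "range h = \<real> \<or> range h = UNIV"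
    using real_or_complex by metis
  have diff: "h (x - y) = h x - h y" for x y
    using add[of "x - y" y] by simp
  have dist: "dist (h x) (h y) = dist x y" for x y
    by (metis diff dist_norm nh)
  have "Cauchy (\<lambda>n. h (X n))"
    using assms by (simp add: Cauchy_def dist)
  then obtain l where l: "(\<lambda>n. h (X n)) \<longlonglongrightarrow> l"
    using Cauchy_convergent convergentD by blast
  have "closed (range h)"
    using ran closed_complex_Reals by auto
  then have "l \<in> range h"
    using l closed_sequentially by (metis rangeI)
  then obtain y where "l = h y" by auto
  then have "X \<longlonglongrightarrow> y"
    using l by (simp add: tendsto_iff dist)
  then show ?thesis by (rule convergentI)
qed

section \<open>Coordinates and bounded linear maps in finite dimension\<close>

context fin_dim_normed_space
begin

lemma tendsto_scale:
  assumes "(u \<longlongrightarrow> l) F"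
  shows "((\<lambda>n. scale (u n) v) \<longlongrightarrow> scale l v) F"
proof -
  have "((\<lambda>n. norm (u n - l) * norm v) \<longlongrightarrow> 0) F"
    using assms by (intro tendsto_mult_left_zero tendsto_norm_zero LIM_zero)
  then have "((\<lambda>n. norm (scale (u n) v - scale l v)) \<longlongrightarrow> 0) F"
    by (simp add: norm_scale flip: scale_left_diff_distrib)
  then show ?thesis
    by (rule LIM_zero_cancel[OF tendsto_norm_zero_cancel])
qed

text \<open>A convergent sequence in the span is Cauchy, and the bound passes this on to each
  coordinate. Completeness of the scalars gives limit coordinates, and the combination formed with
  them is the limit.\<close>

lemma closed_span_if_coordinates_bounded:
  assumes fin: "finite B"
    and C: "\<And>u. (\<Sum>b\<in>B. norm (u b)) \<le> C * norm (\<Sum>b\<in>B. scale (u b) b)"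
  shows "closed (span B)"
  unfolding closed_sequential_limits
proof (intro allI impI, elim conjE)
  fix X x assume X: "\<forall>n. X n \<in> span B" "X \<longlonglongrightarrow> x"
  have "\<forall>n. \<exists>u. X n = (\<Sum>b\<in>B. scale (u b) b)"
    using X(1) span_finite[OF fin] by auto
  then obtain u where u: "\<And>n. X n = (\<Sum>b\<in>B. scale (u n b) b)" by metis
  have Cauchy_X: "Cauchy X"
    using X(2) LIMSEQ_imp_Cauchy by blast
  \<comment> \<open>The hypothesis allows a negative \<open>C\<close>; the absolute value makes the
    factor monotone.\<close>
  have bound: "norm (u m b - u n b) \<le> \<bar>C\<bar> * norm (X m - X n)" if "b \<in> B" for b m n
  proof -
    have "norm (u m b - u n b) \<le> (\<Sum>b\<in>B. norm (u m b - u n b))"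
      using fin that by (intro member_le_sum) auto
    also have "\<dots> \<le> C * norm (X m - X n)"
      using C[of "\<lambda>b. u m b - u n b"] by (simp add: u scale_left_diff_distrib sum_subtractf)
    also have "\<dots> \<le> \<bar>C\<bar> * norm (X m - X n)"
      by (intro mult_right_mono) auto
    finally show ?thesis .
  qed
  have "convergent (\<lambda>n. u n b)" if "b \<in> B" for b
  proof (rule real_or_complex_Cauchy_convergent, rule CauchyI)
    fix e :: real assume e: "0 < e"
    \<comment> \<open>Adding 1 keeps the divisor positive when \<open>C\<close> is 0.\<close>
    then obtain M where M: "\<And>m n. m \<ge> M \<Longrightarrow> n \<ge> M \<Longrightarrow> norm (X m - X n) < e / (\<bar>C\<bar> + 1)"
      using CauchyD[OF Cauchy_X, of "e / (\<bar>C\<bar> + 1)"] by (auto simp: field_simps)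
    have "norm (u m b - u n b) < e" if "m \<ge> M" "n \<ge> M" for m n
    proof -
      have "norm (u m b - u n b) \<le> \<bar>C\<bar> * norm (X m - X n)"
        using bound \<open>b \<in> B\<close> by blast
      also have "\<dots> \<le> (\<bar>C\<bar> + 1) * norm (X m - X n)"
        by (intro mult_right_mono) auto
      also have "\<dots> < e"
        using M[OF that] by (simp add: field_simps)
      finally show ?thesis .
    qed
    then show "\<exists>M. \<forall>m\<ge>M. \<forall>n\<ge>M. norm (u m b - u n b) < e" by blast
  qed
  then obtain l where l: "\<And>b. b \<in> B \<Longrightarrow> (\<lambda>n. u n b) \<longlonglongrightarrow> l b"
    unfolding convergent_def by metis
  have "X \<longlonglongrightarrow> (\<Sum>b\<in>B. scale (l b) b)"
    unfolding u using l by (intro tendsto_sum tendsto_scale)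
  then have "x = (\<Sum>b\<in>B. scale (l b) b)"
    using X(2) LIMSEQ_unique by blast
  then show "x \<in> span B"
    by (simp add: span_sum span_scale span_base)
qed

text \<open>Induction on \<open>B\<close>: the bound for \<open>B\<close> makes its span closed, so
  a new vector \<open>v\<close> has positive distance from it. That distance controls the
  coefficient of \<open>v\<close>; the induction hypothesis controls the other coefficients.\<close>

lemma coordinates_bounded:
  assumes "finite B" "independent B"
  shows "\<exists>C. \<forall>u. (\<Sum>b\<in>B. norm (u b)) \<le> C * norm (\<Sum>b\<in>B. scale (u b) b)"
  using assms
proof (induction B rule: finite_induct)
  case empty
  then show ?case by simp
next
  case (insert v B)
  have v: "v \<notin> span B" and ind: "independent B"
    using insert.prems insert.hyps independent_insert by auto
  obtain C where C: "\<And>u. (\<Sum>b\<in>B. norm (u b)) \<le> C * norm (\<Sum>b\<in>B. scale (u b) b)"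
    using insert.IH[OF ind] by blast
  have "open (- span B)"
    using closed_span_if_coordinates_bounded[OF insert.hyps(1) C] by blast
  \<comment> \<open>\<open>d\<close> is the radius of a ball around \<open>v\<close> inside the open
    complement of the span.\<close>
  then obtain d where d: "d > 0" "\<And>w. w \<in> span B \<Longrightarrow> d \<le> dist w v"
    using v unfolding open_dist by (metis ComplD ComplI not_le)
  have dk: "d * norm k \<le> norm (scale k v + w)" if w: "w \<in> span B" for k w
  proof (cases "k = 0")
    case False
    \<comment> \<open>Dividing by \<open>- k\<close> turns \<open>w\<close> into a point of the span
      to be compared with \<open>v\<close>; multiplying by \<open>norm k\<close> afterwards restores
      the vector in question.\<close>
    have "d \<le> dist (scale (- inverse k) w) v"
      by (intro d span_scale w)
    also have "\<dots> = norm (v + scale (inverse k) w)"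
      by (simp add: dist_norm norm_minus_commute)
    finally have "norm k * d \<le> norm k * norm (v + scale (inverse k) w)"
      by (simp add: mult_left_mono)
    also have "\<dots> = norm (scale k v + w)"
      using False by (simp add: scale_right_distrib flip: norm_scale)
    finally show ?thesis by (simp add: mult.commute)
  qed simp
  \<comment> \<open>The summand \<open>1 / d\<close> pays for the coefficient of \<open>v\<close>.
    The other one pays for the rest \<open>w\<close>, whose norm is at most
    \<open>1 + norm v / d\<close> times that of the whole vector.\<close>
  let ?K = "1 / d + \<bar>C\<bar> * (1 + norm v / d)"
  have "(\<Sum>b\<in>insert v B. norm (u b)) \<le> ?K * norm (\<Sum>b\<in>insert v B. scale (u b) b)" for u
  proof -
    define w where "w = (\<Sum>b\<in>B. scale (u b) b)"
    define N where "N = norm (scale (u v) v + w)"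
    have "w \<in> span B"
      by (simp add: w_def span_sum span_scale span_base)
    then have uv: "norm (u v) \<le> N / d"
      using dk[of w "u v"] d(1) by (simp add: N_def field_simps)
    have "norm w \<le> N + norm (u v) * norm v"
      using norm_triangle_ineq4[of "scale (u v) v + w" "scale (u v) v"]
      by (simp add: N_def norm_scale)
    also have "\<dots> \<le> N + N / d * norm v"
      by (intro add_left_mono mult_right_mono uv) auto
    finally have w_le: "norm w \<le> N + N / d * norm v" .
    have "(\<Sum>b\<in>B. norm (u b)) \<le> C * norm w"
      using C by (simp add: w_def)
    also have "\<dots> \<le> \<bar>C\<bar> * norm w"
      by (intro mult_right_mono) auto
    also have "\<dots> \<le> \<bar>C\<bar> * (N + N / d * norm v)"
      by (intro mult_left_mono w_le) auto
    finally have "norm (u v) + (\<Sum>b\<in>B. norm (u b)) \<le> N / d + \<bar>C\<bar> * (N + N / d * norm v)"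
      using uv by linarith
    also have "\<dots> = ?K * N" by (simp add: algebra_simps)
    finally show ?thesis
      using insert.hyps by (simp add: N_def w_def)
  qed
  then show ?case by blast
qed

text \<open>Expand the argument in a finite basis: its coordinates are bounded by its norm, and
  \<open>f\<close> takes only finitely many values on the basis.\<close>

lemma linear_imp_bounded_linear:
  assumes B: "fin_dim_normed_space sb" and f: "Vector_Spaces.linear scale sb f"
  shows "bounded_linear f"
proof -
  interpret b: fin_dim_normed_space sb by fact
  interpret f: Vector_Spaces.linear scale sb f by fact
  obtain B0 where B0: "finite B0" "span B0 = UNIV"
    using fin_dim by blast
  \<comment> \<open>A finite spanning set need not be independent, which the coordinate bound
    requires; a maximal independent subset still spans.\<close>
  obtain B where B: "B \<subseteq> B0" "independent B" "B0 \<subseteq> span B"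
    using maximal_independent_subset[of B0] by blast
  have fin: "finite B" using B B0 finite_subset by blast
  have span: "span B = UNIV"
    using span_minimal[OF B(3) subspace_span] B0(2) by auto
  obtain C where C: "\<And>u. (\<Sum>b\<in>B. norm (u b)) \<le> C * norm (\<Sum>b\<in>B. scale (u b) b)"
    using coordinates_bounded[OF fin B(2)] by blast
  define M where "M = (\<Sum>b\<in>B. norm (f b))"
  show ?thesis
  proof (rule bounded_linear_intro)
    show "f (x + y) = f x + f y" for x y by (rule f.add)
    \<comment> \<open>Real homogeneity is linearity over \<open>'k\<close> restricted to the scalars
      \<open>of_real r\<close>.\<close>
    show "f (r *\<^sub>R x) = r *\<^sub>R f x" for r x
      by (metis f.scale scale_of_real b.scale_of_real)
    fix x
    have "x \<in> span B" by (simp add: span)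
    then obtain u where u: "x = (\<Sum>b\<in>B. scale (u b) b)"
      unfolding span_finite[OF fin] by blast
    have "norm (f x) = norm (\<Sum>b\<in>B. sb (u b) (f b))"
      by (simp add: u f.sum f.scale)
    also have "\<dots> \<le> (\<Sum>b\<in>B. norm (u b) * norm (f b))"
      using norm_sum[of "\<lambda>b. sb (u b) (f b)" B] by (simp add: b.norm_scale)
    also have "\<dots> \<le> (\<Sum>b\<in>B. norm (u b) * M)"
      unfolding M_def using fin
      by (intro sum_mono mult_left_mono member_le_sum) auto
    also have "\<dots> \<le> C * norm x * M"
      unfolding sum_distrib_right[symmetric] u
      by (intro mult_right_mono C) (simp add: M_def sum_nonneg)
    finally show "norm (f x) \<le> norm x * (C * M)" by (simp add: mult_ac)
  qed
qed

end

section \<open>Comparison with Frechet derivatives\<close>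

text \<open>The limits agree, and finite dimension supplies boundedness. Linearity over
  \<open>'k\<close> stays as a separate conjunct because \<open>has_derivative\<close> records only
  real linearity.\<close>

lemma has_deriv_at_iff_has_derivative:
  assumes "fin_dim_normed_space sa" "fin_dim_normed_space sb"
  shows "has_deriv_at sa sb f f' x \<longleftrightarrow>
    Vector_Spaces.linear sa sb f' \<and> (f has_derivative f') (at x)"
  using fin_dim_normed_space.linear_imp_bounded_linear[OF assms, of f']
  by (auto simp: has_deriv_at_def has_derivative_at diff_diff_eq)

text \<open>Uniqueness of the Frechet derivative makes the definite description pick out
  \<open>f'\<close>.\<close>

lemma deriv_at_eqI:
  assumes "fin_dim_normed_space sa" "fin_dim_normed_space sb" "has_deriv_at sa sb f f' x"
  shows "deriv_at sa sb f x = f'"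
  unfolding deriv_at_def using assms
  by (intro the_equality) (auto simp: has_deriv_at_iff_has_derivative intro: has_derivative_unique)

lemma has_deriv_at_deriv_at:
  assumes "fin_dim_normed_space sa" "fin_dim_normed_space sb" "differentiable_map sa sb f"
  shows "has_deriv_at sa sb f (deriv_at sa sb f x) x"
  using assms deriv_at_eqI unfolding differentiable_map_def by metis

text \<open>The common pattern for the equations: a pointwise candidate \<open>F\<close> yields
  differentiability and, by uniqueness, the value of \<open>D_hat\<close>.\<close>

lemma D_hat_eqI:
  assumes "fin_dim_normed_space sa" "fin_dim_normed_space sb"
    and "\<And>x. fst (F x) = f x"
    and "\<And>x. Vector_Spaces.linear sa sb (snd (F x))"
    and "\<And>x. (f has_derivative snd (F x)) (at x)"
  shows "differentiable_map sa sb f \<and> D_hat sa sb f = F"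
proof -
  have *: "has_deriv_at sa sb f (snd (F x)) x" for x
    using assms by (simp add: has_deriv_at_iff_has_derivative)
  then have "D_hat sa sb f x = F x" for x
    using deriv_at_eqI[OF assms(1,2) *] assms(3)[of x] by (simp add: D_hat_def prod_eq_iff)
  with * show ?thesis by (auto simp: differentiable_map_def)
qed

text \<open>A bounded linear map is its own derivative at every point, and boundedness is automatic
  here.\<close>

lemma D_hat_linear:
  assumes "fin_dim_normed_space sa" "fin_dim_normed_space sb" "Vector_Spaces.linear sa sb f"
  shows "differentiable_map sa sb f \<and> D_hat sa sb f = linearD f"
  using assms fin_dim_normed_space.linear_imp_bounded_linear[OF assms]
  by (intro D_hat_eqI) (auto simp: linearD_def bounded_linear_imp_has_derivative)

section \<open>Linearity and derivatives on products\<close>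

lemma linear_intro:
  assumes "fin_dim_normed_space sa" "fin_dim_normed_space sb"
    and "\<And>x y. f (x + y) = f x + f y" "\<And>k x. f (sa k x) = sb k (f x)"
  shows "Vector_Spaces.linear sa sb f"
  using assms
  by (simp add: Vector_Spaces.linear_iff fin_dim_normed_space_def)

lemma prod_scale_apply:
  assumes "fin_dim_normed_space sa" "fin_dim_normed_space sb"
  shows "prod_scale sa sb k p = (sa k (fst p), sb k (snd p))"
proof -
  interpret a: fin_dim_normed_space sa by fact
  interpret b: fin_dim_normed_space sb by fact
  interpret vector_space_prod sa sb ..
  show ?thesis by (simp add: scale_def case_prod_beta)
qed

lemma linear_map_prod:
  assumes a: "fin_dim_normed_space sa" and b: "fin_dim_normed_space sb"
    and c: "fin_dim_normed_space sc" and d: "fin_dim_normed_space sd"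
    and "Vector_Spaces.linear sa sc f" "Vector_Spaces.linear sb sd g"
  shows "Vector_Spaces.linear (prod_scale sa sb) (prod_scale sc sd) (map_prod f g)"
  using assms(5,6)
  by (intro linear_intro fin_dim_normed_space_prod a b c d)
    (auto simp: Vector_Spaces.linear_iff prod_scale_apply[OF a b] prod_scale_apply[OF c d])

text \<open>The map is the pairing of \<open>f\<close> after \<open>fst\<close> with
  \<open>g\<close> after \<open>snd\<close>, so the chain rule applies in each component.\<close>

lemma has_derivative_map_prod:
  assumes "(f has_derivative f') (at (fst p))" "(g has_derivative g') (at (snd p))"
  shows "(map_prod f g has_derivative map_prod f' g') (at p)"
proof -
  have "((\<lambda>q. (f (fst q), g (snd q))) has_derivative (\<lambda>q. (f' (fst q), g' (snd q)))) (at p)"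
    by (intro has_derivative_Pair
        has_derivative_compose[OF has_derivative_fst[OF has_derivative_ident] assms(1)]
        has_derivative_compose[OF has_derivative_snd[OF has_derivative_ident] assms(2)])
  then show ?thesis by (simp add: map_prod_def case_prod_beta')
qed

section \<open>Functoriality, products and numeric operations\<close>

text \<open>Each equation is paired with differentiability, since \<open>deriv_at\<close> is a
  definite description and is meaningful only where a derivative exists.\<close>

theorem mainTheorem1:
  fixes sa :: "'k::real_or_complex \<Rightarrow> 'a::real_normed_vector \<Rightarrow> 'a"
    and sb :: "'k \<Rightarrow> 'b::real_normed_vector \<Rightarrow> 'b"
    and sc :: "'k \<Rightarrow> 'c::real_normed_vector \<Rightarrow> 'c"
    and sd :: "'k \<Rightarrow> 'd::real_normed_vector \<Rightarrow> 'd"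
  assumes a: "fin_dim_normed_space sa"
    and b: "fin_dim_normed_space sb"
    and c: "fin_dim_normed_space sc"
    and d: "fin_dim_normed_space sd"
  shows
    "(\<forall>f. differentiable_map sa sb f \<longrightarrow> D_hat sa sb f \<in> D_hom sa sb) \<and>
     (differentiable_map sa sa id \<and> D_hat sa sa id = idD) \<and>
     (\<forall>f g. differentiable_map sa sb f \<and> differentiable_map sb sc g \<longrightarrow>
        differentiable_map sa sc (g \<circ> f) \<and>
        D_hat sa sc (g \<circ> f) = D_hat sb sc g \<circ>\<^sub>D D_hat sa sb f) \<and>
     (\<forall>f g. differentiable_map sa sc f \<and> differentiable_map sb sd g \<longrightarrow>
        differentiable_map (prod_scale sa sb) (prod_scale sc sd) (map_prod f g) \<and>
        D_hat (prod_scale sa sb) (prod_scale sc sd) (map_prod f g) =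
          D_hat sa sc f \<times>\<^sub>D D_hat sb sd g) \<and>
     (differentiable_map (prod_scale sa sb) sa fst \<and> D_hat (prod_scale sa sb) sa fst = exlD) \<and>
     (differentiable_map (prod_scale sa sb) sb snd \<and> D_hat (prod_scale sa sb) sb snd = exrD) \<and>
     (differentiable_map sa (prod_scale sa sa) dup \<and> D_hat sa (prod_scale sa sa) dup = dupD) \<and>
     (differentiable_map ((*) :: 'k \<Rightarrow> 'k \<Rightarrow> 'k) (*) negateC \<and>
        D_hat ((*) :: 'k \<Rightarrow> 'k \<Rightarrow> 'k) (*) negateC = negateCD) \<and>
     (differentiable_map (prod_scale ((*) :: 'k \<Rightarrow> 'k \<Rightarrow> 'k) (*)) (*) addC \<and>
        D_hat (prod_scale ((*) :: 'k \<Rightarrow> 'k \<Rightarrow> 'k) (*)) (*) addC = addCD) \<and>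
     (differentiable_map (prod_scale ((*) :: 'k \<Rightarrow> 'k \<Rightarrow> 'k) (*)) (*) mulC \<and>
        D_hat (prod_scale ((*) :: 'k \<Rightarrow> 'k \<Rightarrow> 'k) (*)) (*) mulC = mulCD)"
proof (intro conjI allI impI; (elim conjE)?)
  note k = fin_dim_normed_space_scalars[where 'k='k]
  note prod = fin_dim_normed_space_prod
  note kk = prod[OF k k] and ab = prod[OF a b] and aa = prod[OF a a]
  \<comment> \<open>This map and the next five are linear, so only additivity and homogeneity remain
    to be checked; multiplication needs the product rule.\<close>
  have id: "differentiable_map sa sa id \<and> D_hat sa sa id = idD"
    unfolding idD_def by (intro D_hat_linear linear_intro a) auto
  have fst: "differentiable_map (prod_scale sa sb) sa fst \<and> D_hat (prod_scale sa sb) sa fst = exlD"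
    unfolding exlD_def
    by (intro D_hat_linear linear_intro a ab) (auto simp: prod_scale_apply[OF a b])
  have snd: "differentiable_map (prod_scale sa sb) sb snd \<and> D_hat (prod_scale sa sb) sb snd = exrD"
    unfolding exrD_def
    by (intro D_hat_linear linear_intro b ab) (auto simp: prod_scale_apply[OF a b])
  have dup: "differentiable_map sa (prod_scale sa sa) dup \<and> D_hat sa (prod_scale sa sa) dup = dupD"
    unfolding dupD_def
    by (intro D_hat_linear linear_intro a aa) (auto simp: prod_scale_apply[OF a a] dup_def)
  have neg: "differentiable_map ((*) :: 'k \<Rightarrow> 'k \<Rightarrow> 'k) (*) negateC \<and>
      D_hat ((*) :: 'k \<Rightarrow> 'k \<Rightarrow> 'k) (*) negateC = negateCD"
    unfolding negateCD_def
    by (intro D_hat_linear linear_intro k) (auto simp: negateC_def)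
  have add: "differentiable_map (prod_scale ((*) :: 'k \<Rightarrow> 'k \<Rightarrow> 'k) (*)) (*) addC \<and>
      D_hat (prod_scale ((*) :: 'k \<Rightarrow> 'k \<Rightarrow> 'k) (*)) (*) addC = addCD"
    unfolding addCD_def
    by (intro D_hat_linear linear_intro k kk)
      (auto simp: addC_def prod_scale_apply[OF k k] algebra_simps)
  have mul: "differentiable_map (prod_scale ((*) :: 'k \<Rightarrow> 'k \<Rightarrow> 'k) (*)) (*) mulC \<and>
      D_hat (prod_scale ((*) :: 'k \<Rightarrow> 'k \<Rightarrow> 'k) (*)) (*) mulC = mulCD"
  proof (intro D_hat_eqI k kk)
    fix p :: "'k \<times> 'k"
    show "fst (mulCD p) = mulC p"
      by (simp add: mulCD_def mulC_def case_prod_beta)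
    show "Vector_Spaces.linear (prod_scale (*) (*)) (*) (snd (mulCD p))"
      by (intro linear_intro k kk)
        (auto simp: mulCD_def join_def scale_map_def case_prod_beta prod_scale_apply[OF k k]
          algebra_simps)
    \<comment> \<open>For \<open>p = (x, y)\<close> and \<open>q = (u, v)\<close> the product rule
      gives \<open>x * v + u * y\<close>, which commutativity turns into
      \<open>(scale_map y \<nabla> scale_map x) q\<close>.\<close>
    have "((\<lambda>q :: 'k \<times> 'k. fst q * snd q) has_derivative
        (\<lambda>q. fst p * snd q + fst q * snd p)) (at p)"
      by (intro has_derivative_mult has_derivative_fst has_derivative_snd has_derivative_ident)
    then show "(mulC has_derivative snd (mulCD p)) (at p)"
      by (simp add: mulC_def mulCD_def join_def scale_map_def case_prod_beta' algebra_simps)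
  qed
  note D = id fst snd dup neg add mul
  show "differentiable_map sa sa id" "D_hat sa sa id = idD"
    "differentiable_map (prod_scale sa sb) sa fst" "D_hat (prod_scale sa sb) sa fst = exlD"
    "differentiable_map (prod_scale sa sb) sb snd" "D_hat (prod_scale sa sb) sb snd = exrD"
    "differentiable_map sa (prod_scale sa sa) dup" "D_hat sa (prod_scale sa sa) dup = dupD"
    "differentiable_map ((*) :: 'k \<Rightarrow> 'k \<Rightarrow> 'k) (*) negateC"
    "D_hat ((*) :: 'k \<Rightarrow> 'k \<Rightarrow> 'k) (*) negateC = negateCD"
    "differentiable_map (prod_scale ((*) :: 'k \<Rightarrow> 'k \<Rightarrow> 'k) (*)) (*) addC"
    "D_hat (prod_scale ((*) :: 'k \<Rightarrow> 'k \<Rightarrow> 'k) (*)) (*) addC = addCD"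
    "differentiable_map (prod_scale ((*) :: 'k \<Rightarrow> 'k \<Rightarrow> 'k) (*)) (*) mulC"
    "D_hat (prod_scale ((*) :: 'k \<Rightarrow> 'k \<Rightarrow> 'k) (*)) (*) mulC = mulCD"
    using D by blast+
next
  fix f assume "differentiable_map sa sb f"
  from has_deriv_at_deriv_at[OF a b this] show "D_hat sa sb f \<in> D_hom sa sb"
    by (simp add: D_hom_def D_hat_def has_deriv_at_def)
next
  fix f g assume f: "differentiable_map sa sb f" and g: "differentiable_map sb sc g"
  note f' = has_deriv_at_deriv_at[OF a b f, unfolded has_deriv_at_iff_has_derivative[OF a b]]
    and g' = has_deriv_at_deriv_at[OF b c g, unfolded has_deriv_at_iff_has_derivative[OF b c]]
  \<comment> \<open>The second component of \<open>compD\<close> is the derivative of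
    \<open>g\<close> at \<open>f x\<close> composed with that of \<open>f\<close> at
    \<open>x\<close>, as in the chain rule.\<close>
  have "differentiable_map sa sc (g \<circ> f) \<and>
      D_hat sa sc (g \<circ> f) = D_hat sb sc g \<circ>\<^sub>D D_hat sa sb f"
    using f' g'
    by (intro D_hat_eqI a c)
      (auto simp: compD_def D_hat_def intro: Vector_Spaces.linear_compose diff_chain_at)
  then show "differentiable_map sa sc (g \<circ> f)"
    "D_hat sa sc (g \<circ> f) = D_hat sb sc g \<circ>\<^sub>D D_hat sa sb f" by blast+
next
  fix f g assume f: "differentiable_map sa sc f" and g: "differentiable_map sb sd g"
  note f' = has_deriv_at_deriv_at[OF a c f, unfolded has_deriv_at_iff_has_derivative[OF a c]]
    and g' = has_deriv_at_deriv_at[OF b d g, unfolded has_deriv_at_iff_has_derivative[OF b d]]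
  \<comment> \<open>The candidate derivative at \<open>(x, y)\<close> is \<open>map_prod\<close> of
    the derivatives at \<open>x\<close> and at \<open>y\<close>.\<close>
  have "differentiable_map (prod_scale sa sb) (prod_scale sc sd) (map_prod f g) \<and>
      D_hat (prod_scale sa sb) (prod_scale sc sd) (map_prod f g) =
        D_hat sa sc f \<times>\<^sub>D D_hat sb sd g"
    using f' g'
    by (intro D_hat_eqI fin_dim_normed_space_prod a b c d)
      (auto simp: crossD_def D_hat_def intro!: linear_map_prod[OF a b c d] has_derivative_map_prod)
  then show "differentiable_map (prod_scale sa sb) (prod_scale sc sd) (map_prod f g)"
    "D_hat (prod_scale sa sb) (prod_scale sc sd) (map_prod f g) =
      D_hat sa sc f \<times>\<^sub>D D_hat sb sd g" by blast+
qed

end
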